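(* Let $g_{11},g_{21},g_{12},g_{22}>0$, $P_1,P_2>0$, and let $\mu\ge 0$ with $\mu\ne 1$. For a power allocation $(P_{11},P_{21},P_{12},P_{22})$ with $P_{jk}\ge 0$ for $j,k\in\{1,2\}$, $P_{11}+P_{21}\le P_1$ and $P_{12}+P_{22}\le P_2$, put $$R_1=\log_2\Big(1+\frac{g_{11}P_{11}+g_{12}P_{12}}{1+g_{11}P_{21}+g_{12}P_{22}}\Big),\qquad R_2=\log_2\Big(1+\frac{g_{21}P_{21}+g_{22}P_{22}}{1+g_{21}P_{11}+g_{22}P_{12}}\Big).$$ Then any power allocation that maximizes $R_1+\mu R_2$ over this constraint set satisfies $P_{1k}P_{2k}=0$ for $k=1,2$, and $(P_{11},P_{21},P_{12},P_{22})$ has one of the following forms: (i) (corner points) $(P_1,0,P_2,0)$, $(0,P_1,0,P_2)$, $(0,P_1,P_2,0)$, or $(P_1,0,0,P_2)$; (ii) (stationary points for $\mu>1$) if $\mu>1$: $(P_{11}^*,0,0,P_2)$ with $0\le P_{11}^*<P_1$, or $(0,P_1,P_{12}^*,0)$ with $0\le P_{12}^*<P_2$; (iii) (stationary points for $\mu<1$) if $\mu<1$: $(P_1,0,0,P_{22}^* )$ with $0\le P_{22}^*<P_2$, or $(0,P_{21}^*,P_2,0)$ with $0\le P_{21}^*<P_1$. In (ii) and (iii), $P_{jk}^*$ is a stationary point of $R_1+\mu R_2$ as a function of the single variable $P_{jk}$, the other three powers being fixed at the displayed values (i.e. the derivative with respect to $P_{jk}$ vanishes at $P_{jk}^*$)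.
   Context: Here $g_{jk}$ is the channel gain from base station $k$ to mobile $j$, $P_{jk}$ is the power base station $k$ allocates to mobile $j$, $P_k$ is the power budget of base station $k$, $R_j$ is the rate of mobile $j$, and $\mu$ is the relative priority weight of mobile 2. *)

theory Defs
  imports Complex_Main
begin

text \<open>
  A power allocation is a quadruple \<open>(P11, P21, P12, P22)\<close>, where \<open>Pjk\<close> is the power that base
  station \<open>k\<close> allocates to mobile \<open>j\<close>; \<open>gjk\<close> is the channel gain from base station \<open>k\<close> to
  mobile \<open>j\<close>. The noise power is normalised to 1.
\<close>

type_synonym allocation = "real \<times> real \<times> real \<times> real"

definition feasible :: "real \<Rightarrow> real \<Rightarrow> allocation set" where
  "feasible P1 P2 = {(P11, P21, P12, P22).
     0 \<le> P11 \<and> 0 \<le> P21 \<and> 0 \<le> P12 \<and> 0 \<le> P22 \<and> P11 + P21 \<le> P1 \<and> P12 + P22 \<le> P2}"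

definition rate1 :: "real \<Rightarrow> real \<Rightarrow> allocation \<Rightarrow> real" where
  "rate1 g11 g12 = (\<lambda>(P11, P21, P12, P22).
     log 2 (1 + (g11 * P11 + g12 * P12) / (1 + g11 * P21 + g12 * P22)))"

definition rate2 :: "real \<Rightarrow> real \<Rightarrow> allocation \<Rightarrow> real" where
  "rate2 g21 g22 = (\<lambda>(P11, P21, P12, P22).
     log 2 (1 + (g21 * P21 + g22 * P22) / (1 + g21 * P11 + g22 * P12)))"

definition weighted_rate ::
    "real \<Rightarrow> real \<Rightarrow> real \<Rightarrow> real \<Rightarrow> real \<Rightarrow> allocation \<Rightarrow> real" where
  "weighted_rate g11 g21 g12 g22 \<mu> p = rate1 g11 g12 p + \<mu> * rate2 g21 g22 p"

end

theory Submission
  imports Defs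
begin

text \<open>
  With total received powers \<open>T1\<close>, \<open>T2\<close> and interference levels \<open>I1\<close>, \<open>I2\<close>, the objective is
  \<open>ln T1 - ln I1 + \<mu> (ln T2 - ln I2)\<close> up to the factor \<open>ln 2\<close>. Redistributing the power of one
  base station between the mobiles keeps \<open>T1\<close> and \<open>T2\<close> fixed, and the objective is strictly
  convex along this exchange, so at an optimum each base station serves a single mobile. If both
  serve the same mobile, full power is optimal. If they serve different mobiles, scaling both powers
  up improves both rates, so one of them is at its budget. The partial derivative in the other
  power has the sign of a quadratic polynomial; when the mobile served with that power has at least
  the priority of the other one, this polynomial is strictly increasing on the nonnegative axis, so
  an interior stationary point cannot be a maximum. Swapping the base stations and swapping the
  mobiles reduces all cases to one.
\<close>

section \<open>Optimal allocations and the symmetries of the problem\<close>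

definition optimal ::
    "real \<Rightarrow> real \<Rightarrow> real \<Rightarrow> real \<Rightarrow> real \<Rightarrow> real \<Rightarrow> real \<Rightarrow> allocation \<Rightarrow> bool" where
  "optimal g11 g21 g12 g22 \<mu> P1 P2 =
     is_arg_max (weighted_rate g11 g21 g12 g22 \<mu>) (\<lambda>p. p \<in> feasible P1 P2)"

lemma optimal_feasible:
  assumes "optimal g11 g21 g12 g22 \<mu> P1 P2 (a, b, c, d)"
  shows "0 \<le> a" "0 \<le> b" "0 \<le> c" "0 \<le> d" "a + b \<le> P1" "c + d \<le> P2"
  using assms by (auto simp: optimal_def is_arg_max_def feasible_def)

lemma optimal_ge:
  assumes "optimal g11 g21 g12 g22 \<mu> P1 P2 p"
    and "0 \<le> a" "0 \<le> b" "0 \<le> c" "0 \<le> d" "a + b \<le> P1" "c + d \<le> P2"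
  shows "weighted_rate g11 g21 g12 g22 \<mu> (a, b, c, d) \<le> weighted_rate g11 g21 g12 g22 \<mu> p"
  using assms by (auto simp: optimal_def is_arg_max_def feasible_def not_less)

lemma weighted_rate_swap_stations:
  "weighted_rate g11 g21 g12 g22 \<mu> (a, b, c, d) = weighted_rate g12 g22 g11 g21 \<mu> (c, d, a, b)"
  by (simp add: weighted_rate_def rate1_def rate2_def add_ac)

text \<open>Renaming the mobiles gives \<open>R2 + R1 / \<mu>\<close>, the old objective up to the
  factor \<open>1 / \<mu>\<close>. So the regimes \<mu> > 1 and \<mu> < 1 are mirror images.\<close>

lemma weighted_rate_swap_mobiles:
  assumes "\<mu> \<noteq> 0"
  shows "weighted_rate g21 g11 g22 g12 (1 / \<mu>) (b, a, d, c)
    = weighted_rate g11 g21 g12 g22 \<mu> (a, b, c, d) / \<mu>"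
  using assms by (simp add: weighted_rate_def rate1_def rate2_def field_simps)

lemma optimal_swap_stations:
  assumes "optimal g11 g21 g12 g22 \<mu> P1 P2 (a, b, c, d)"
  shows "optimal g12 g22 g11 g21 \<mu> P2 P1 (c, d, a, b)"
  using assms unfolding optimal_def is_arg_max_def feasible_def
  by (auto simp: weighted_rate_swap_stations[of g12 g22 g11 g21])

lemma optimal_swap_mobiles:
  assumes "optimal g11 g21 g12 g22 \<mu> P1 P2 (a, b, c, d)" and "\<mu> > 0"
  shows "optimal g21 g11 g22 g12 (1 / \<mu>) P1 P2 (b, a, d, c)"
proof -
  have "weighted_rate g21 g11 g22 g12 (1 / \<mu>) (b', a', d', c')
      \<le> weighted_rate g21 g11 g22 g12 (1 / \<mu>) (b, a, d, c)"
    if "0 \<le> a'" "0 \<le> b'" "0 \<le> c'" "0 \<le> d'" "b' + a' \<le> P1" "d' + c' \<le> P2" for a' b' c' d'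
    using optimal_ge[OF assms(1), of a' b' c' d'] that \<open>\<mu> > 0\<close>
    by (simp add: weighted_rate_swap_mobiles divide_right_mono add.commute)
  then show ?thesis
    using optimal_feasible[OF assms(1)]
    by (fastforce simp: optimal_def is_arg_max_def feasible_def not_less add.commute)
qed

section \<open>Logarithmic form of the objective and exclusive service\<close>

text \<open>The first logarithm of each pair sees only the sums \<open>a + b\<close> and
  \<open>c + d\<close>, so shifting power between mobiles at one station changes the interference
  terms alone.\<close>

lemma weighted_rate_ln:
  assumes "g11 > 0" "g21 > 0" "g12 > 0" "g22 > 0" "0 \<le> a" "0 \<le> b" "0 \<le> c" "0 \<le> d"
  shows "weighted_rate g11 g21 g12 g22 \<mu> (a, b, c, d) =
    (ln (1 + g11 * (a + b) + g12 * (c + d)) - ln (1 + g11 * b + g12 * d)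
     + \<mu> * (ln (1 + g21 * (a + b) + g22 * (c + d)) - ln (1 + g21 * a + g22 * c))) / ln 2"
proof -
  have ln_ratio: "ln (1 + S / I) = ln (S + I) - ln I" if "0 \<le> S" "0 < I" for S I :: real
  proof -
    have "1 + S / I = (S + I) / I" using that by (simp add: field_simps)
    then show ?thesis using that by (simp add: ln_div)
  qed
  have I: "0 < 1 + g11 * b + g12 * d" "0 < 1 + g21 * a + g22 * c"
    using assms by (auto intro!: add_pos_nonneg)
  have S: "0 \<le> g11 * a + g12 * c" "0 \<le> g21 * b + g22 * d"
    using assms by auto
  have T: "1 + g11 * (a + b) + g12 * (c + d) = (g11 * a + g12 * c) + (1 + g11 * b + g12 * d)"
    "1 + g21 * (a + b) + g22 * (c + d) = (g21 * b + g22 * d) + (1 + g21 * a + g22 * c)"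
    by (simp_all add: algebra_simps)
  show ?thesis
    unfolding T ln_ratio[OF S(1) I(1), symmetric] ln_ratio[OF S(2) I(2), symmetric]
    by (simp add: weighted_rate_def rate1_def rate2_def log_def add_divide_distrib)
qed

text \<open>Strict concavity of \<open>ln\<close>, from \<open>ln z \<le> z - 1\<close> at
  \<open>z = y / x\<close>, with equality only for \<open>z = 1\<close>.\<close>

lemma ln_less_tangent:
  fixes x y :: real
  assumes "0 < x" "0 < y" "x \<noteq> y"
  shows "ln y - ln x < (y - x) / x"
proof -
  have "ln (y / x) \<le> y / x - 1" "ln (y / x) \<noteq> y / x - 1"
    using assms ln_le_minus_one[of "y / x"] ln_eq_minus_one[of "y / x"] by auto
  then show ?thesis using assms by (simp add: ln_div diff_divide_distrib)
qed

lemma optimal_exclusive: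
  assumes g: "g11 > 0" "g21 > 0" "g12 > 0" "g22 > 0" and "\<mu> \<ge> 0"
    and opt: "optimal g11 g21 g12 g22 \<mu> P1 P2 (a, b, c, d)"
  shows "a * b = 0"
proof (rule ccontr)
  note f = optimal_feasible[OF opt]
  assume "a * b \<noteq> 0"
  then have ab: "a > 0" "b > 0" using f by auto
  define I1 where "I1 = 1 + g11 * b + g12 * d"
  define I2 where "I2 = 1 + g21 * a + g22 * c"
  define K where "K = \<mu> * g21 / I2 - g11 / I1"
  have I: "I1 > 0" "I2 > 0"
    using g f by (auto simp: I1_def I2_def intro!: add_pos_nonneg)
  \<comment> \<open>\<open>K\<close> is the slope of the objective in the exchanged power \<open>e\<close>. By strict convexity the objective
    exceeds its tangent, so optimality forces \<open>K * e < 0\<close> for exchanges in both directions.\<close>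
  have no_gain: "K * e < 0" if e: "e \<noteq> 0" "-b \<le> e" "e \<le> a" for e
  proof -
    let ?J1 = "I1 + g11 * e" and ?J2 = "I2 - g21 * e"
    have J1: "?J1 = 1 + g11 * (b + e) + g12 * d" and J2: "?J2 = 1 + g21 * (a - e) + g22 * c"
      by (simp_all add: I1_def I2_def algebra_simps)
    have "?J1 > 0" "?J2 > 0"
      unfolding J1 J2 using g f e by (auto intro!: add_pos_nonneg mult_nonneg_nonneg)
    then have "ln ?J1 - ln I1 < g11 * e / I1" and "ln ?J2 - ln I2 < - g21 * e / I2"
      using ln_less_tangent[of I1 ?J1] ln_less_tangent[of I2 ?J2] I e g by auto
    moreover from this(2) have "\<mu> * (ln ?J2 - ln I2) \<le> \<mu> * (- g21 * e / I2)"
      using \<open>\<mu> \<ge> 0\<close> by (intro mult_left_mono) auto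
    moreover have "g11 * e / I1 + \<mu> * (- g21 * e / I2) = - (K * e)"
      by (simp add: K_def algebra_simps)
    ultimately have "ln ?J1 - ln I1 + \<mu> * (ln ?J2 - ln I2) < - (K * e)" by linarith
    moreover have "0 \<le> ln ?J1 - ln I1 + \<mu> * (ln ?J2 - ln I2)"
    proof -
      have "weighted_rate g11 g21 g12 g22 \<mu> (a - e, b + e, c, d)
          \<le> weighted_rate g11 g21 g12 g22 \<mu> (a, b, c, d)"
        using f e by (intro optimal_ge[OF opt]) auto
      then show ?thesis
        using g f e unfolding J1 J2
        by (simp add: weighted_rate_ln divide_le_cancel I1_def I2_def right_diff_distrib)
    qed
    ultimately show ?thesis by linarith
  qed
  \<comment> \<open>The two extreme exchanges, each handing the station to one mobile, have opposite
    signs, so \<open>K\<close> would be both negative and positive.\<close>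
  have "K * a < 0" "K * (- b) < 0" using ab by (intro no_gain; simp)+
  then show False using ab by (simp add: mult_less_0_iff zero_less_mult_iff)
qed

section \<open>Use of the full power budgets\<close>

text \<open>With mobile 2 unserved there is no interference, and the objective is the logarithm of
  \<open>1 + g11 * a + g12 * c\<close>, strictly increasing in both powers.\<close>

lemma optimal_single_mobile:
  assumes g: "g11 > 0" "g21 > 0" "g12 > 0" "g22 > 0"
    and opt: "optimal g11 g21 g12 g22 \<mu> P1 P2 (a, 0, c, 0)"
  shows "a = P1 \<and> c = P2"
proof -
  note f = optimal_feasible[OF opt]
  have "weighted_rate g11 g21 g12 g22 \<mu> (P1, 0, P2, 0)
      \<le> weighted_rate g11 g21 g12 g22 \<mu> (a, 0, c, 0)"
    using f by (intro optimal_ge[OF opt]) auto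
  moreover have "0 < 1 + g11 * P1 + g12 * P2" "0 < 1 + g11 * a + g12 * c"
    using f g by (auto intro!: add_pos_nonneg)
  ultimately have "g11 * P1 + g12 * P2 \<le> g11 * a + g12 * c"
    using f g by (simp add: weighted_rate_ln divide_le_cancel)
  moreover have "g11 * a \<le> g11 * P1" "g12 * c \<le> g12 * P2" using f g by auto
  ultimately have "g11 * a = g11 * P1" "g12 * c = g12 * P2" by linarith+
  then show ?thesis using g by auto
qed

text \<open>This case is treated directly because exchanging the mobiles divides by \<mu>. Only
  \<open>R1\<close> counts, and it is best with full signal and no interference.\<close>

lemma optimal_zero_priority:
  assumes g: "g11 > 0" "g12 > 0" and P: "P1 > 0" "P2 > 0"
    and opt: "optimal g11 g21 g12 g22 0 P1 P2 (a, b, c, d)"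
  shows "(a, b, c, d) = (P1, 0, P2, 0)"
proof -
  note f = optimal_feasible[OF opt]
  define M where "M = g11 * P1 + g12 * P2"
  define I where "I = 1 + (g11 * b + g12 * d)"
  have "M > 0" using g P by (simp add: M_def add_pos_pos)
  have nonneg: "0 \<le> g11 * b" "0 \<le> g12 * d" "0 \<le> g11 * a + g12 * c" using f g by auto
  then have "I > 0" by (simp add: I_def)
  have le: "g11 * a \<le> g11 * P1" "g12 * c \<le> g12 * P2" using f g by auto
  have "weighted_rate g11 g21 g12 g22 0 (P1, 0, P2, 0)
      \<le> weighted_rate g11 g21 g12 g22 0 (a, b, c, d)"
    using P by (intro optimal_ge[OF opt]) auto
  then have "log 2 (1 + M) \<le> log 2 (1 + (g11 * a + g12 * c) / I)"
    by (simp add: weighted_rate_def rate1_def M_def I_def add.assoc)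
  then have "M \<le> (g11 * a + g12 * c) / I"
    using \<open>M > 0\<close> \<open>I > 0\<close> nonneg by (subst (asm) log_le_cancel_iff) (auto intro!: add_pos_nonneg)
  \<comment> \<open>The signal is at most \<open>M\<close>, so this leaves no room for an
    \<open>I\<close> above the noise level 1.\<close>
  then have *: "M * I \<le> g11 * a + g12 * c" using \<open>I > 0\<close> by (simp add: field_simps)
  also have "\<dots> \<le> M" using le by (simp add: M_def)
  finally have "I \<le> 1" using \<open>M > 0\<close> by simp
  then have "g11 * b = 0" "g12 * d = 0" using nonneg unfolding I_def by linarith+
  then have "b = 0" "d = 0" "I = 1" using g by (auto simp: I_def)
  moreover have "g11 * a = g11 * P1" "g12 * c = g12 * P2"
    using * le unfolding \<open>I = 1\<close> M_def mult_1_right by linarith+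
  ultimately show ?thesis using g by auto
qed

lemma optimal_full_power:
  assumes g: "g11 > 0" "g21 > 0" "g12 > 0" "g22 > 0" and "\<mu> \<ge> 0"
    and opt: "optimal g11 g21 g12 g22 \<mu> P1 P2 (a, 0, 0, d)" and ad: "a > 0" "d > 0"
  shows "a = P1 \<or> d = P2"
proof (rule ccontr)
  assume neg: "\<not> (a = P1 \<or> d = P2)"
  \<comment> \<open>The largest common scaling factor that respects both budgets.\<close>
  define r where "r = min (P1 / a) (P2 / d)"
  have "a < P1" "d < P2" using optimal_feasible[OF opt] neg by auto
  then have "r > 1" using ad by (simp add: r_def)
  have "r * a \<le> P1" "r * d \<le> P2" using ad by (auto simp: r_def min_def field_simps)
  then have "weighted_rate g11 g21 g12 g22 \<mu> (r * a, 0, 0, r * d)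
      \<le> weighted_rate g11 g21 g12 g22 \<mu> (a, 0, 0, d)"
    using ad \<open>r > 1\<close> by (intro optimal_ge[OF opt]) auto
  \<comment> \<open>The signal grows by the factor \<open>r\<close>, noise plus interference by
    less, since the noise 1 does not scale.\<close>
  moreover have sinr: "h * x / (1 + k * y) < h * (r * x) / (1 + k * (r * y))"
    if "h > 0" "k > 0" "x > 0" "y > 0" for h k x y
  proof -
    have "0 < 1 + k * y" "0 < 1 + k * (r * y)" using that \<open>r > 1\<close> by (simp_all add: add_pos_pos)
    moreover have "h * x * 1 < h * x * r" using that \<open>r > 1\<close> by (intro mult_strict_left_mono) auto
    ultimately show ?thesis by (simp add: divide_simps) (simp add: algebra_simps)
  qed
  have "log 2 (1 + g11 * a / (1 + g12 * d)) < log 2 (1 + g11 * (r * a) / (1 + g12 * (r * d)))"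
    using sinr[of g11 g12 a d] g ad by (intro log_less) (auto intro!: add_pos_pos divide_pos_pos)
  moreover have "log 2 (1 + g22 * d / (1 + g21 * a)) \<le> log 2 (1 + g22 * (r * d) / (1 + g21 * (r * a)))"
    using sinr[of g22 g21 d a] g ad by (intro log_mono) (auto intro!: add_pos_pos divide_pos_pos)
  ultimately show False
    using \<open>\<mu> \<ge> 0\<close> mult_left_mono[of _ _ \<mu>]
    by (fastforce simp: weighted_rate_def rate1_def rate2_def)
qed

section \<open>Stationary points when the stations serve different mobiles\<close>

lemma weighted_rate_deriv:
  assumes g: "g11 > 0" "g21 > 0" "g12 > 0" "g22 > 0" and "x > 0" "d > 0"
  shows "((\<lambda>t. weighted_rate g11 g21 g12 g22 \<mu> (t, 0, 0, d)) has_real_derivative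
    (g11 * (1 + g21 * x) * (1 + g21 * x + g22 * d) - \<mu> * g21 * g22 * d * (1 + g11 * x + g12 * d))
      / ((1 + g11 * x + g12 * d) * (1 + g21 * x) * (1 + g21 * x + g22 * d) * ln 2)) (at x)"
proof -
  let ?L = "\<lambda>t. (ln (1 + g11 * t + g12 * d) - ln (1 + g12 * d)
     + \<mu> * (ln (1 + g21 * t + g22 * d) - ln (1 + g21 * t))) / ln 2"
  have pos: "0 < 1 + g11 * x + g12 * d" "0 < 1 + g21 * x + g22 * d" "0 < 1 + g21 * x"
    using assms by (auto intro!: add_pos_pos)
  have "(?L has_real_derivative
      (g11 / (1 + g11 * x + g12 * d)
       + \<mu> * (g21 / (1 + g21 * x + g22 * d) - g21 / (1 + g21 * x))) / ln 2) (at x)"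
    using pos by (auto intro!: derivative_eq_intros)
  also have "(g11 / (1 + g11 * x + g12 * d)
       + \<mu> * (g21 / (1 + g21 * x + g22 * d) - g21 / (1 + g21 * x))) / ln 2
    = (g11 * (1 + g21 * x) * (1 + g21 * x + g22 * d) - \<mu> * g21 * g22 * d * (1 + g11 * x + g12 * d))
      / ((1 + g11 * x + g12 * d) * (1 + g21 * x) * (1 + g21 * x + g22 * d) * ln 2)"
    (is "(_ / ?T + _ * (_ / ?U - _ / ?V)) / _ = _")
  proof -
    have "?V - ?U = - (g22 * d)" by simp
    then have "g21 / ?U - g21 / ?V = - (g21 * g22 * d) / (?U * ?V)"
      using pos by (simp add: diff_frac_eq flip: right_diff_distrib)
    moreover have "(g / T + m * (- k / (U * V))) / l = (g * V * U - m * k * T) / (T * V * U * l)"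
      if "T \<noteq> 0" "U \<noteq> 0" "V \<noteq> 0" "l \<noteq> 0" for g T m k U V l :: real
      using that by (simp add: field_simps)
    ultimately show ?thesis
      using pos by (simp add: mult.assoc)
  qed
  \<comment> \<open>The logarithmic form is available only for nonnegative powers, so the derivative
    is transferred on the open half-line.\<close>
  finally show ?thesis
    by (rule has_field_derivative_transform_within_open[where S = "{0<..}"])
      (use assms in \<open>auto simp: weighted_rate_ln\<close>)
qed

lemma optimal_interior:
  assumes g: "g11 > 0" "g21 > 0" "g12 > 0" "g22 > 0"
    and opt: "optimal g11 g21 g12 g22 \<mu> P1 P2 (x, 0, 0, d)" and x: "0 < x" "x < P1" and d: "d > 0"
  shows "((\<lambda>t. weighted_rate g11 g21 g12 g22 \<mu> (t, 0, 0, d)) has_real_derivative 0) (at x)"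
    and "\<mu> > 1"
proof -
  let ?f = "\<lambda>t. weighted_rate g11 g21 g12 g22 \<mu> (t, 0, 0, d)"
  define q where "q t = g11 * (1 + g21 * t) * (1 + g21 * t + g22 * d)
    - \<mu> * g21 * g22 * d * (1 + g11 * t + g12 * d)" for t
  define D where
    "D t = (1 + g11 * t + g12 * d) * (1 + g21 * t) * (1 + g21 * t + g22 * d) * ln 2" for t
  have deriv: "(?f has_real_derivative q t / D t) (at t)" if "t > 0" for t
    using weighted_rate_deriv[OF g that d] by (simp add: q_def D_def)
  have D_pos: "D t > 0" if "t > 0" for t
    using that g d by (auto simp: D_def intro!: mult_pos_pos add_pos_pos)
  have max: "?f y \<le> ?f x" if "0 \<le> y" "y \<le> P1" for y
    using that optimal_feasible[OF opt] by (intro optimal_ge[OF opt]) auto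
  \<comment> \<open>The radius \<open>min x (P1 - x)\<close> keeps the neighbourhood inside the
    feasible interval.\<close>
  have stationary: "q x / D x = 0"
    by (rule DERIV_local_max[OF deriv[OF x(1)], of "min x (P1 - x)"]) (use x max in \<open>auto\<close>)
  then show "(?f has_real_derivative 0) (at x)"
    using deriv[OF x(1)] by (simp only: stationary)
  have qx: "q x = 0" using stationary D_pos[OF x(1)] by simp
  show "\<mu> > 1"
  proof (rule ccontr)
    assume "\<not> \<mu> > 1"
    have "q t > 0" if "x < t" for t
    proof -
      \<comment> \<open>For \<mu> \<le> 1 the last factor is positive, so \<open>q\<close> is
        positive to the right of its zero \<open>x\<close>.\<close>
      have "q t - q x = g11 * g21 * (t - x) * (2 + g21 * (t + x) + g22 * d * (1 - \<mu>))"
        by (simp add: q_def algebra_simps)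
      also have "\<dots> > 0"
        using g d x that \<open>\<not> \<mu> > 1\<close> by (auto intro!: mult_pos_pos add_pos_nonneg)
      finally show ?thesis using qx by simp
    qed
    then have increasing: "\<exists>y. (?f has_real_derivative y) (at t) \<and> 0 < y" if "x < t" for t
      using deriv[of t] D_pos[of t] x that by (intro exI[of _ "q t / D t"]) auto
    moreover have "continuous_on {x..P1} ?f"
    proof (rule continuous_at_imp_continuous_on, intro ballI)
      fix t assume "t \<in> {x..P1}"
      then show "isCont ?f t" using DERIV_isCont[OF deriv[of t]] x by simp
    qed
    \<comment> \<open>The derivative vanishes at \<open>x\<close> itself, hence the criterion with
      positivity on the open interval and continuity on the closed one.\<close>
    ultimately have "?f x < ?f P1"
      by (intro DERIV_pos_imp_increasing_open[OF x(2)] increasing)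
    then show False using max[of P1] x by simp
  qed
qed

text \<open>Exchanging both mobiles and stations turns \<open>(a, 0, 0, x)\<close> into
  \<open>(x, 0, 0, a)\<close> with priority \<open>1 / \<mu>\<close>, so the varying power again
  belongs to mobile 1.\<close>

lemma optimal_interior_mobile2:
  assumes g: "g11 > 0" "g21 > 0" "g12 > 0" "g22 > 0" and "\<mu> > 0"
    and opt: "optimal g11 g21 g12 g22 \<mu> P1 P2 (a, 0, 0, x)" and x: "0 < x" "x < P2" and a: "a > 0"
  shows "((\<lambda>t. weighted_rate g11 g21 g12 g22 \<mu> (a, 0, 0, t)) has_real_derivative 0) (at x)"
    and "\<mu> < 1"
proof -
  have opt': "optimal g22 g12 g21 g11 (1 / \<mu>) P2 P1 (x, 0, 0, a)"
    by (rule optimal_swap_stations[OF optimal_swap_mobiles[OF opt \<open>\<mu> > 0\<close>]])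
  have eq: "weighted_rate g11 g21 g12 g22 \<mu> (a, 0, 0, t)
      = \<mu> * weighted_rate g22 g12 g21 g11 (1 / \<mu>) (t, 0, 0, a)" for t
    using weighted_rate_swap_mobiles[of \<mu> g22 g12 g21 g11 t 0 0 a] \<open>\<mu> > 0\<close>
      weighted_rate_swap_stations[of g11 g21 g12 g22 \<mu> a 0 0 t]
    by (simp add: field_simps)
  note * = optimal_interior[OF g(4,3,2,1) opt' x a]
  show "((\<lambda>t. weighted_rate g11 g21 g12 g22 \<mu> (a, 0, 0, t)) has_real_derivative 0) (at x)"
    using DERIV_cmult[OF *(1), of \<mu>] by (simp add: eq)
  show "\<mu> < 1" using *(2) \<open>\<mu> > 0\<close> by simp
qed

section \<open>Combining the cases\<close>

lemma optimal_split:
  assumes g: "g11 > 0" "g21 > 0" "g12 > 0" "g22 > 0" and "\<mu> > 0"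
    and opt: "optimal g11 g21 g12 g22 \<mu> P1 P2 (a, 0, 0, d)" and ad: "a > 0" "d > 0"
  shows "(a = P1 \<and> d = P2)
    \<or> (\<mu> > 1 \<and> a < P1 \<and> d = P2 \<and>
        ((\<lambda>t. weighted_rate g11 g21 g12 g22 \<mu> (t, 0, 0, P2)) has_real_derivative 0) (at a))
    \<or> (\<mu> < 1 \<and> a = P1 \<and> d < P2 \<and>
        ((\<lambda>t. weighted_rate g11 g21 g12 g22 \<mu> (P1, 0, 0, t)) has_real_derivative 0) (at d))"
proof -
  have "a \<le> P1" "d \<le> P2" using optimal_feasible[OF opt] by auto
  moreover have "a = P1 \<or> d = P2" using optimal_full_power[OF g _ opt ad] \<open>\<mu> > 0\<close> by simp
  ultimately consider "a = P1" "d = P2" | "a < P1" "d = P2" | "a = P1" "d < P2" by linarith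
  then show ?thesis
  proof cases
    case 1
    then show ?thesis by simp
  next
    case 2
    then show ?thesis using optimal_interior[OF g opt ad(1) _ ad(2)] by simp
  next
    case 3
    then show ?thesis using optimal_interior_mobile2[OF g \<open>\<mu> > 0\<close> opt ad(2) _ ad(1)] by simp
  qed
qed

theorem proposition2:
  fixes g11 g21 g12 g22 P1 P2 \<mu> P11 P21 P12 P22 :: real
  assumes "g11 > 0" and "g21 > 0" and "g12 > 0" and "g22 > 0"
    and "P1 > 0" and "P2 > 0"
    and "\<mu> \<ge> 0" and "\<mu> \<noteq> 1"
    and "is_arg_max (weighted_rate g11 g21 g12 g22 \<mu>)
           (\<lambda>p. p \<in> feasible P1 P2) (P11, P21, P12, P22)"
  shows "P11 * P21 = 0 \<and> P12 * P22 = 0 \<and>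
    ((P11, P21, P12, P22) \<in>
        {(P1, 0, P2, 0), (0, P1, 0, P2), (0, P1, P2, 0), (P1, 0, 0, P2)}
     \<or> \<mu> > 1 \<and>
        ((\<exists>x. 0 \<le> x \<and> x < P1 \<and> (P11, P21, P12, P22) = (x, 0, 0, P2) \<and>
            ((\<lambda>t. weighted_rate g11 g21 g12 g22 \<mu> (t, 0, 0, P2))
               has_real_derivative 0) (at x))
         \<or> (\<exists>x. 0 \<le> x \<and> x < P2 \<and> (P11, P21, P12, P22) = (0, P1, x, 0) \<and>
            ((\<lambda>t. weighted_rate g11 g21 g12 g22 \<mu> (0, P1, t, 0))
               has_real_derivative 0) (at x)))
     \<or> \<mu> < 1 \<and>
        ((\<exists>x. 0 \<le> x \<and> x < P2 \<and> (P11, P21, P12, P22) = (P1, 0, 0, x) \<and>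
            ((\<lambda>t. weighted_rate g11 g21 g12 g22 \<mu> (P1, 0, 0, t))
               has_real_derivative 0) (at x))
         \<or> (\<exists>x. 0 \<le> x \<and> x < P1 \<and> (P11, P21, P12, P22) = (0, x, P2, 0) \<and>
            ((\<lambda>t. weighted_rate g11 g21 g12 g22 \<mu> (0, t, P2, 0))
               has_real_derivative 0) (at x))))"
proof -
  note g = assms(1-4)
  have opt: "optimal g11 g21 g12 g22 \<mu> P1 P2 (P11, P21, P12, P22)"
    using assms by (simp add: optimal_def)
  note opt' = optimal_swap_stations[OF opt]
  note f = optimal_feasible[OF opt]
  have excl: "P11 * P21 = 0" "P12 * P22 = 0"
    using optimal_exclusive[OF g \<open>\<mu> \<ge> 0\<close> opt] optimal_exclusive[OF g(3,4,1,2) \<open>\<mu> \<ge> 0\<close> opt'] by auto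
  show ?thesis
  proof (cases "\<mu> = 0")
    case True
    then show ?thesis
      using optimal_zero_priority[OF g(1,3) \<open>P1 > 0\<close> \<open>P2 > 0\<close>, of g21 g22 P11 P21 P12 P22] opt by simp
  next
    case False
    then have "\<mu> > 0" using \<open>\<mu> \<ge> 0\<close> by simp
    \<comment> \<open>Allocations with a silent station fall under the single-mobile cases, so in
      the split cases both active powers are positive.\<close>
    consider "P21 = 0" "P22 = 0" | "P11 = 0" "P12 = 0"
      | "P21 = 0" "P12 = 0" "P11 > 0" "P22 > 0" | "P11 = 0" "P22 = 0" "P21 > 0" "P12 > 0"
      using excl f by fastforce
    then show ?thesis
    proof cases
      case 1
      then show ?thesis using optimal_single_mobile[OF g] opt by simp
    next
      case 2
      then show ?thesis
        using optimal_single_mobile[OF g(2,1,4,3)] optimal_swap_mobiles[OF opt \<open>\<mu> > 0\<close>] by simp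
    next
      case 3
      then show ?thesis using optimal_split[OF g \<open>\<mu> > 0\<close>, of P1 P2 P11 P22] opt by auto
    next
      case 4
      then show ?thesis
        \<comment> \<open>Exchanging the stations alone maps \<open>(0, P21, P12, 0)\<close> to
          \<open>(P12, 0, 0, P21)\<close> and keeps \<mu>.\<close>
        using optimal_split[OF g(3,4,1,2) \<open>\<mu> > 0\<close>, of P2 P1 P12 P21] opt'
        by (auto simp: weighted_rate_swap_stations[of g12 g22 g11 g21])
    qed
  qed
qed

end
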